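(* Let $G=(\Sigma,\Gamma,S_0,R)$ be a context-free grammar, let $X\in\Gamma$ be a non-terminal symbol and let $n$ be a positive integer. Let $G_X=(\Sigma,\Gamma\times\{0,1,2\},(S_0,1),R_X)$ be the context-free grammar whose set of rules is $R_X=R_0\cup R_1\cup R_1'\cup R_2$, where \begin{itemize} \item $R_0=\{(Z,0)\to [w]_0 \mid Z\to w\in R\}$, \item $R_1=\{(Z,1)\to w' \mid Z\neq X \text{ and there exists } Z\to w\in R \text{ such that } w'\in\{w\}_{1,2}\}$, \item $R_1'=\{(X,1)\to [w]_0 \mid X\to w\in R\}$, \item $R_2=\{(Z,2)\to [w]_2 \mid Z\to w\in R \text{ and } Z\neq X\}$. \end{itemize} Then there exists a bijection between $E_n(G_X)$, the set of derivation trees of $G_X$ with $n$ nodes, and $E_{X,n}(G)$, the set of derivation trees of $G$ with $n$ nodes that cover $X$.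
   Context: A context-free grammar is a tuple $G=(\Sigma,\Gamma,S_0,R)$ where $\Sigma$ (terminal symbols) and $\Gamma$ (non-terminal symbols) are disjoint finite alphabets, $S_0\in\Gamma$ is the initial symbol, and $R$ is a finite subset of $\Gamma\times(\Sigma\cup\Gamma)^*$. An element $(Z,w)\in R$ is called a rule and is also written $Z\to w$. The pairs in $\Gamma\times\{0,1,2\}$ are treated as formal symbols, so that $\Sigma$ and $\Gamma\times\{0,1,2\}$ are disjoint. The empty word is denoted $\varepsilon$. A derivation tree of $G$ is a finite ordered tree (considered up to isomorphism of labelled ordered trees) whose internal nodes are labelled by elements of $\Gamma$, whose leaves are labelled by elements of $\Sigma\cup\{\varepsilon\}$, whose root is labelled by $S_0$, and such that whenever a node is labelled by $Z\in\Gamma$ and its children are labelled $\alpha_1,\ldots,\alpha_k$ in this order, then either $k=1$, $\alpha_1=\varepsilon$ and $(Z,\varepsilon)\in R$, or all $\alpha_i$ are in $\Gamma\cup\Sigma$ and $(Z,\alpha_1\cdots\alpha_k)\in R$. The size of a derivation tree is its number of nodes (all nodes are counted, including leaves labelled by $\varepsilon$). A derivation tree covers $X\in\Gamma$ if at least one of its nodes is labelled by $X$. $E_n(G)$ denotes the set of derivation trees of $G$ of size $n$, and $E_{X,n}(G)$ denotes the set of derivation trees of $G$ of size $n$ covering $X$. Notation on words $w\in(\Gamma\cup\Sigma)^*$: - For $i\in\{0,2\}$, $[w]_i$ is the word obtained from $w$ by replacing every occurrence of each letter $Z\in\Gamma$ by $(Z,i)$ and leaving the letters of $\Sigma$ unchanged.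 - $\{w\}_{1,2}$ is the set of all words $w'\in(\Sigma\cup(\Gamma\times\{1,2\}))^*$ obtained from $w$ by leaving the letters of $\Sigma$ unchanged and replacing each occurrence of a letter $Z\in\Gamma$ either by $(Z,1)$ or by $(Z,2)$ (independently for each occurrence), with the restriction that at least one occurrence is replaced by a pair with second component $1$. In particular $\{w\}_{1,2}=\emptyset$ if $w\in\Sigma^*$. *)

theory Defs
  imports Main
begin

text \<open>Terminals and non-terminals live in separate summands of the following type, so the
  two alphabets of a grammar are disjoint by construction.\<close>

datatype ('t, 'n) symbol = Tm 't | Nt 'n

record ('t, 'n) grammar =
  terminals :: "'t set"
  nonterminals :: "'n set"
  start :: 'n
  rules :: "('n \<times> ('t, 'n) symbol list) set"

definition symbols :: "('t, 'n) grammar \<Rightarrow> ('t, 'n) symbol set" where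
  "symbols G = Tm ` terminals G \<union> Nt ` nonterminals G"

definition context_free_grammar :: "('t, 'n) grammar \<Rightarrow> bool" where
  "context_free_grammar G \<longleftrightarrow>
     finite (terminals G) \<and> finite (nonterminals G) \<and> start G \<in> nonterminals G \<and>
     finite (rules G) \<and> rules G \<subseteq> nonterminals G \<times> lists (symbols G)"

text \<open>Elements of the following datatype are finite ordered labelled trees up to isomorphism.\<close>

datatype (labels: 'l) otree = Node (root: 'l) (children: "'l otree list")

primrec subtrees :: "'l otree \<Rightarrow> 'l otree set" where
  "subtrees (Node l ts) = insert (Node l ts) (\<Union> (set (map subtrees ts)))"

primrec num_nodes :: "'l otree \<Rightarrow> nat" where
  "num_nodes (Node l ts) = Suc (sum_list (map num_nodes ts))"

datatype ('t, 'n) label = Eps | Sym "('t, 'n) symbol"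

definition valid_leaf :: "('t, 'n) grammar \<Rightarrow> ('t, 'n) label \<Rightarrow> bool" where
  "valid_leaf G l \<longleftrightarrow> l = Eps \<or> (\<exists>a \<in> terminals G. l = Sym (Tm a))"

definition valid_internal ::
  "('t, 'n) grammar \<Rightarrow> ('t, 'n) label \<Rightarrow> ('t, 'n) label list \<Rightarrow> bool" where
  "valid_internal G l ls \<longleftrightarrow>
     (\<exists>Z \<in> nonterminals G. l = Sym (Nt Z) \<and>
        (ls = [Eps] \<and> (Z, []) \<in> rules G \<or>
         (\<exists>w \<in> lists (symbols G). ls = map Sym w \<and> (Z, w) \<in> rules G)))"

text \<open>The nodes of a tree correspond to its subtrees. A node without children is a leaf, so
  \<^const>\<open>valid_internal\<close> is only ever applied to a nonempty list of child labels; a rule with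
  empty right-hand side is therefore used only through a single child labelled \<^const>\<open>Eps\<close>.\<close>

definition derivation_tree :: "('t, 'n) grammar \<Rightarrow> ('t, 'n) label otree \<Rightarrow> bool" where
  "derivation_tree G t \<longleftrightarrow>
     root t = Sym (Nt (start G)) \<and>
     (\<forall>s \<in> subtrees t.
        if children s = [] then valid_leaf G (root s)
        else valid_internal G (root s) (map root (children s)))"

definition covers :: "('t, 'n) label otree \<Rightarrow> 'n \<Rightarrow> bool" where
  "covers t X \<longleftrightarrow> Sym (Nt X) \<in> labels t"

definition E :: "nat \<Rightarrow> ('t, 'n) grammar \<Rightarrow> ('t, 'n) label otree set" where
  "E n G = {t. derivation_tree G t \<and> num_nodes t = n}"

definition E_cov :: "'n \<Rightarrow> nat \<Rightarrow> ('t, 'n) grammar \<Rightarrow> ('t, 'n) label otree set" where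
  "E_cov X n G = {t. derivation_tree G t \<and> num_nodes t = n \<and> covers t X}"

definition tag :: "nat \<Rightarrow> ('t, 'n) symbol list \<Rightarrow> ('t, 'n \<times> nat) symbol list" where
  "tag i w = map (map_symbol id (\<lambda>Z. (Z, i))) w"

definition tag12_symbol :: "('t, 'n) symbol \<Rightarrow> ('t, 'n \<times> nat) symbol set" where
  "tag12_symbol a = (case a of Tm c \<Rightarrow> {Tm c} | Nt Z \<Rightarrow> {Nt (Z, 1), Nt (Z, 2)})"

definition tag12 :: "('t, 'n) symbol list \<Rightarrow> ('t, 'n \<times> nat) symbol list set" where
  "tag12 w = {w'. list_all2 (\<lambda>a b. b \<in> tag12_symbol a) w w' \<and> (\<exists>Z. Nt (Z, 1) \<in> set w')}"

definition rules0 :: "('t, 'n) grammar \<Rightarrow> (('n \<times> nat) \<times> ('t, 'n \<times> nat) symbol list) set" where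
  "rules0 G = {((Z, 0), tag 0 w) | Z w. (Z, w) \<in> rules G}"

definition rules1 ::
  "('t, 'n) grammar \<Rightarrow> 'n \<Rightarrow> (('n \<times> nat) \<times> ('t, 'n \<times> nat) symbol list) set" where
  "rules1 G X = {((Z, 1), w') | Z w'. Z \<noteq> X \<and> (\<exists>w. (Z, w) \<in> rules G \<and> w' \<in> tag12 w)}"

definition rules1' ::
  "('t, 'n) grammar \<Rightarrow> 'n \<Rightarrow> (('n \<times> nat) \<times> ('t, 'n \<times> nat) symbol list) set" where
  "rules1' G X = {((X, 1), tag 0 w) | w. (X, w) \<in> rules G}"

definition rules2 ::
  "('t, 'n) grammar \<Rightarrow> 'n \<Rightarrow> (('n \<times> nat) \<times> ('t, 'n \<times> nat) symbol list) set" where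
  "rules2 G X = {((Z, 2), tag 2 w) | Z w. (Z, w) \<in> rules G \<and> Z \<noteq> X}"

definition cover_grammar :: "('t, 'n) grammar \<Rightarrow> 'n \<Rightarrow> ('t, 'n \<times> nat) grammar" where
  "cover_grammar G X =
     \<lparr>terminals = terminals G,
      nonterminals = nonterminals G \<times> {0, 1, 2},
      start = (start G, 1),
      rules = rules0 G \<union> rules1 G X \<union> rules1' G X \<union> rules2 G X\<rparr>"

lemma tag_in_lists:
  assumes "w \<in> lists (symbols G)" "i \<in> {0, 1, 2}"
  shows "tag i w \<in> lists (symbols (cover_grammar G X))"
proof (rule in_listsI, rule ballI)
  fix b assume "b \<in> set (tag i w)"
  then obtain a where a: "a \<in> set w" "b = map_symbol id (\<lambda>Z. (Z, i)) a"
    by (auto simp: tag_def)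
  then have "a \<in> symbols G"
    using assms(1) by (simp add: in_lists_conv_set)
  then show "b \<in> symbols (cover_grammar G X)"
    using a(2) assms(2) by (auto simp: symbols_def cover_grammar_def)
qed

lemma tag12_in_lists:
  assumes "w \<in> lists (symbols G)" "w' \<in> tag12 w"
  shows "w' \<in> lists (symbols (cover_grammar G X))"
proof -
  have "list_all2 (\<lambda>a b. b \<in> tag12_symbol a) w w'"
    using assms(2) by (simp add: tag12_def)
  then show ?thesis
    using assms(1)
  proof (induction rule: list_all2_induct)
    case Nil
    show ?case by simp
  next
    case (Cons a w b w')
    then have "b \<in> symbols (cover_grammar G X)"
      by (auto simp: tag12_symbol_def symbols_def cover_grammar_def split: symbol.splits)
    with Cons show ?case by simp
  qed
qed

lemma context_free_grammar_cover_grammar: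
  assumes G: "context_free_grammar G" and X: "X \<in> nonterminals G"
  shows "context_free_grammar (cover_grammar G X)"
proof -
  let ?H = "cover_grammar G X"
  have R: "Z \<in> nonterminals G" "w \<in> lists (symbols G)" if "(Z, w) \<in> rules G" for Z w
    using G that by (auto simp: context_free_grammar_def)
  have fin_sym: "finite (symbols ?H)"
    using G by (simp add: context_free_grammar_def symbols_def cover_grammar_def)
  have fin12: "finite (tag12 w)" if "w \<in> lists (symbols G)" for w
  proof (rule finite_subset)
    show "tag12 w \<subseteq> {w'. set w' \<subseteq> symbols ?H \<and> length w' = length w}"
      using tag12_in_lists[OF that] by (fastforce simp: tag12_def dest: list_all2_lengthD)
    show "finite {w'. set w' \<subseteq> symbols ?H \<and> length w' = length w}"
      by (rule finite_lists_length_eq[OF fin_sym])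
  qed
  have fin: "finite (rules G)"
    using G by (simp add: context_free_grammar_def)
  have "rules0 G \<subseteq> (\<lambda>(Z, w). ((Z, 0), tag 0 w)) ` rules G"
    "rules1' G X \<subseteq> (\<lambda>(Z, w). ((Z, 1), tag 0 w)) ` rules G"
    "rules2 G X \<subseteq> (\<lambda>(Z, w). ((Z, 2), tag 2 w)) ` rules G"
    by (auto simp: rules0_def rules1'_def rules2_def)
  then have fin0: "finite (rules0 G)" "finite (rules1' G X)" "finite (rules2 G X)"
    using fin by (meson finite_imageI finite_subset)+
  have "rules1 G X \<subseteq> (\<Union>(Z, w) \<in> rules G. (\<lambda>w'. ((Z, 1), w')) ` tag12 w)"
    by (fastforce simp: rules1_def)
  moreover have "finite (\<Union>(Z, w) \<in> rules G. (\<lambda>w'. ((Z, 1), w')) ` tag12 w)"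
    using fin fin12 R by auto
  ultimately have fin1: "finite (rules1 G X)"
    by (rule finite_subset)
  have mem: "((Z, i), w') \<in> nonterminals ?H \<times> lists (symbols ?H)"
    if "Z \<in> nonterminals G" "i \<in> {0, 1, 2}" "w' \<in> lists (symbols ?H)" for Z i w'
    using that by (simp add: cover_grammar_def)
  have "rules ?H \<subseteq> nonterminals ?H \<times> lists (symbols ?H)"
  proof
    fix r assume "r \<in> rules ?H"
    then consider
      Z w where "r = ((Z, 0), tag 0 w)" "(Z, w) \<in> rules G"
      | Z w w' where "r = ((Z, 1), w')" "(Z, w) \<in> rules G" "w' \<in> tag12 w"
      | w where "r = ((X, 1), tag 0 w)" "(X, w) \<in> rules G"
      | Z w where "r = ((Z, 2), tag 2 w)" "(Z, w) \<in> rules G"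
      unfolding cover_grammar_def rules0_def rules1_def rules1'_def rules2_def by fastforce
    then show "r \<in> nonterminals ?H \<times> lists (symbols ?H)"
    proof cases
      case (1 Z w)
      have "tag 0 w \<in> lists (symbols ?H)"
        by (rule tag_in_lists[OF R(2)[OF 1(2)]]) simp
      then show ?thesis unfolding 1(1) by (rule mem[OF R(1)[OF 1(2)], rotated]) simp
    next
      case (2 Z w w')
      have "w' \<in> lists (symbols ?H)"
        by (rule tag12_in_lists[OF R(2)[OF 2(2)] 2(3)])
      then show ?thesis unfolding 2(1) by (rule mem[OF R(1)[OF 2(2)], rotated]) simp
    next
      case (3 w)
      have "tag 0 w \<in> lists (symbols ?H)"
        by (rule tag_in_lists[OF R(2)[OF 3(2)]]) simp
      then show ?thesis unfolding 3(1) by (rule mem[OF X, rotated]) simp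
    next
      case (4 Z w)
      have "tag 2 w \<in> lists (symbols ?H)"
        by (rule tag_in_lists[OF R(2)[OF 4(2)]]) simp
      then show ?thesis unfolding 4(1) by (rule mem[OF R(1)[OF 4(2)], rotated]) simp
    qed
  qed
  moreover have "finite (rules ?H)"
    using fin0 fin1 by (simp add: cover_grammar_def)
  moreover have "finite (terminals ?H)" "finite (nonterminals ?H)" "start ?H \<in> nonterminals ?H"
    using G by (simp_all add: context_free_grammar_def cover_grammar_def)
  ultimately show ?thesis
    by (simp only: context_free_grammar_def)
qed

end

theory Submission
  imports Defs
begin

text \<open>The second component of a non-terminal of \<^term>\<open>cover_grammar G X\<close> records what is
  demanded of the subtree below it: 1 means that it contains \<open>X\<close>, 2 that it does not, and 0
  (used strictly below an occurrence of \<open>X\<close> that is first on its branch) nothing at all. Erasing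
  these components maps derivation trees of \<^term>\<open>cover_grammar G X\<close> to derivation trees of \<open>G\<close>
  covering \<open>X\<close>. Conversely the components are determined by the erased tree, so the erasure is
  invertible.\<close>

section \<open>Validity of trees with arbitrary root\<close>

text \<open>The node condition of \<open>derivation_tree\<close> without the start symbol: this form
  passes to subtrees, as the inductions require.\<close>

definition valid_tree :: "('t, 'n) grammar \<Rightarrow> ('t, 'n) label otree \<Rightarrow> bool" where
  "valid_tree G t \<longleftrightarrow>
     (\<forall>s \<in> subtrees t.
        if children s = [] then valid_leaf G (root s)
        else valid_internal G (root s) (map root (children s)))"

lemma valid_tree_Node:
  "valid_tree G (Node l ts) \<longleftrightarrow>
     (if ts = [] then valid_leaf G l else valid_internal G l (map root ts)) \<and>
     (\<forall>s \<in> set ts. valid_tree G s)"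
  by (auto simp: valid_tree_def)

lemma derivation_tree_iff:
  "derivation_tree G t \<longleftrightarrow> root t = Sym (Nt (start G)) \<and> valid_tree G t"
  by (simp add: derivation_tree_def valid_tree_def)

lemma covers_Node: "covers (Node l ts) X \<longleftrightarrow> l = Sym (Nt X) \<or> (\<exists>s \<in> set ts. covers s X)"
  by (auto simp: covers_def)

lemma root_map_otree: "root (map_otree f t) = f (root t)"
  by (cases t) simp

lemma num_nodes_map_otree: "num_nodes (map_otree f t) = num_nodes t"
  by (induction t) (simp add: comp_def cong: map_cong)

section \<open>Marking and erasing labels\<close>

fun mark :: "nat \<Rightarrow> ('t, 'n) label \<Rightarrow> ('t, 'n \<times> nat) label" where
  "mark i Eps = Eps"
| "mark i (Sym (Tm a)) = Sym (Tm a)"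
| "mark i (Sym (Nt Z)) = Sym (Nt (Z, i))"

fun unmark :: "('t, 'n \<times> nat) label \<Rightarrow> ('t, 'n) label" where
  "unmark Eps = Eps"
| "unmark (Sym (Tm a)) = Sym (Tm a)"
| "unmark (Sym (Nt p)) = Sym (Nt (fst p))"

text \<open>\<open>Eps\<close> and terminals satisfy this for every \<open>I\<close>, so a condition
  on marks can be imposed on all children at once.\<close>

definition marked :: "nat set \<Rightarrow> ('t, 'n \<times> nat) label \<Rightarrow> bool" where
  "marked I l \<longleftrightarrow> (\<forall>Z i. l = Sym (Nt (Z, i)) \<longrightarrow> i \<in> I)"

lemma marked_Nt [simp]: "marked I (Sym (Nt (Z, i))) \<longleftrightarrow> i \<in> I"
  by (simp add: marked_def)

lemma unmark_mark [simp]: "unmark (mark i l) = l"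
  by (cases "(i, l)" rule: mark.cases) auto

lemma marked_mark [simp]: "i \<in> I \<Longrightarrow> marked I (mark i l)"
  by (cases "(i, l)" rule: mark.cases) (auto simp: marked_def)

lemma mark_unmark: "marked {i} l \<Longrightarrow> mark i (unmark l) = l"
  by (cases l rule: unmark.cases) (auto simp: marked_def)

lemma map_otree_unmark_mark [simp]: "map_otree unmark (map_otree (mark i) t) = t"
  by (simp add: otree.map_comp comp_def otree.map_ident)

lemma unmark_eq_Nt: "unmark l = Sym (Nt Z) \<longleftrightarrow> (\<exists>i. l = Sym (Nt (Z, i)))"
  by (cases l rule: unmark.cases) auto

section \<open>Rules of the cover grammar in terms of child labels\<close>

text \<open>Confines to one place the convention that an empty right-hand side yields a single
  \<open>Eps\<close> child.\<close>

definition rhs_labels :: "('t, 'n) symbol list \<Rightarrow> ('t, 'n) label list" where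
  "rhs_labels w = (if w = [] then [Eps] else map Sym w)"

text \<open>Well-formedness of the grammar supplies the alphabet conditions, and
  \<open>ls \<noteq> []\<close> prevents an empty right-hand side from being read as an empty list
  of children.\<close>

lemma valid_internal_iff:
  assumes "context_free_grammar G" "ls \<noteq> []"
  shows "valid_internal G l ls \<longleftrightarrow>
    (\<exists>Z w. l = Sym (Nt Z) \<and> (Z, w) \<in> rules G \<and> ls = rhs_labels w)"
proof -
  have "Z \<in> nonterminals G" "w \<in> lists (symbols G)" if "(Z, w) \<in> rules G" for Z w
    using assms(1) that by (auto simp: context_free_grammar_def)
  then show ?thesis
    using assms(2) unfolding valid_internal_def rhs_labels_def
    by (auto split: if_splits) fastforce+
qed

lemma mark_Sym: "mark i (Sym a) = Sym (map_symbol id (\<lambda>Z. (Z, i)) a)"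
  by (cases a) auto

lemma rhs_labels_tag: "rhs_labels (tag i w) = map (mark i) (rhs_labels w)"
  by (simp add: rhs_labels_def tag_def mark_Sym)

text \<open>\<open>mark i\<close> and \<open>unmark\<close> are mutually inverse between plain
  labels and labels satisfying \<open>marked {i}\<close>.\<close>

lemma rhs_labels_tag_iff:
  "ls = rhs_labels (tag i w) \<longleftrightarrow> map unmark ls = rhs_labels w \<and> (\<forall>l \<in> set ls. marked {i} l)"
proof -
  have "map (mark i) (map unmark ls) = ls" if "\<forall>l \<in> set ls. marked {i} l"
    using that by (induction ls) (auto simp: mark_unmark)
  moreover have "map unmark (map (mark i) ms) = ms" for ms
    by (induction ms) auto
  moreover have "\<forall>l \<in> set (map (mark i) ms). marked {i} l" for ms
    by simp
  ultimately show ?thesis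
    unfolding rhs_labels_tag by metis
qed

lemma tag12_symbol_iff:
  "b \<in> tag12_symbol a \<longleftrightarrow> unmark (Sym b) = Sym a \<and> marked {1, 2} (Sym b)"
  by (cases a; cases b) (auto simp: tag12_symbol_def marked_def)

lemma list_all2_tag12_symbol_iff:
  "list_all2 (\<lambda>a b. b \<in> tag12_symbol a) w w' \<longleftrightarrow>
     map unmark (map Sym w') = map Sym w \<and> (\<forall>l \<in> set (map Sym w'). marked {1, 2} l)"
proof (induction w arbitrary: w')
  case Nil
  show ?case by auto
next
  case (Cons a w)
  show ?case
    by (cases w') (auto simp: Cons.IH tag12_symbol_iff[of _ a])
qed

lemma map_Sym_if_map_unmark_eq_map_Sym:
  assumes "map unmark ls = map Sym w"
  shows "\<exists>w'. ls = map Sym w'"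
proof -
  have "\<exists>s. l = Sym s" if "l \<in> set ls" for l
  proof -
    have "unmark l \<in> set (map unmark ls)"
      using that by simp
    then show ?thesis
      unfolding assms by (cases l) auto
  qed
  then show ?thesis
    by (simp add: ex_map_conv)
qed

text \<open>A child with mark 1 forces \<open>w\<close> to be nonempty, so \<open>Eps\<close> does
  not occur and labels can be compared with symbols position by position.\<close>

lemma rhs_labels_tag12_iff:
  "(\<exists>w' \<in> tag12 w. ls = rhs_labels w') \<longleftrightarrow>
   map unmark ls = rhs_labels w \<and> (\<forall>l \<in> set ls. marked {1, 2} l) \<and>
   (\<exists>Y. Sym (Nt (Y, 1)) \<in> set ls)" (is "?L \<longleftrightarrow> ?R")
proof
  assume ?L
  then obtain w' where w': "w' \<in> tag12 w" "ls = rhs_labels w'"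
    by blast
  then obtain Y where Y: "Nt (Y, 1) \<in> set w'"
    and all2: "list_all2 (\<lambda>a b. b \<in> tag12_symbol a) w w'"
    by (auto simp: tag12_def)
  from Y have "w' \<noteq> []"
    by auto
  with all2 have "w \<noteq> []"
    by auto
  moreover have "Sym (Nt (Y, 1)) \<in> set ls"
    using Y \<open>w' \<noteq> []\<close> w'(2) by (simp add: rhs_labels_def)
  ultimately show ?R
    using all2 w'(2) \<open>w' \<noteq> []\<close> unfolding list_all2_tag12_symbol_iff rhs_labels_def by auto
next
  assume R: ?R
  then obtain Y where Y: "Sym (Nt (Y, 1)) \<in> set ls"
    by blast
  have "w \<noteq> []"
  proof
    assume "w = []"
    then have "map unmark ls = [Eps]"
      using R by (simp add: rhs_labels_def)
    then show False
      using Y by auto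
  qed
  then have w: "map unmark ls = map Sym w"
    using R by (simp add: rhs_labels_def)
  then obtain w' where w': "ls = map Sym w'"
    using map_Sym_if_map_unmark_eq_map_Sym by blast
  have "list_all2 (\<lambda>a b. b \<in> tag12_symbol a) w w'"
    unfolding list_all2_tag12_symbol_iff using R w w' by simp
  moreover have "Nt (Y, 1) \<in> set w'"
    using Y w' by auto
  ultimately have "w' \<in> tag12 w" "ls = rhs_labels w'"
    using w' by (auto simp: tag12_def rhs_labels_def)
  then show ?L
    by blast
qed

text \<open>Validity in the cover grammar splits into validity of the unmarked labels in \<open>G\<close> and a
  condition on marks that does not mention the rules of \<open>G\<close>.\<close>

definition valid_marks ::
  "'n \<Rightarrow> ('t, 'n \<times> nat) label \<Rightarrow> ('t, 'n \<times> nat) label list \<Rightarrow> bool" where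
  "valid_marks X l ls \<longleftrightarrow> (\<exists>Z i. l = Sym (Nt (Z, i)) \<and>
     (i = 0 \<and> (\<forall>l \<in> set ls. marked {0} l) \<or>
      i = 1 \<and> Z = X \<and> (\<forall>l \<in> set ls. marked {0} l) \<or>
      i = 1 \<and> Z \<noteq> X \<and> (\<forall>l \<in> set ls. marked {1, 2} l) \<and>
        (\<exists>Y. Sym (Nt (Y, 1)) \<in> set ls) \<or>
      i = 2 \<and> Z \<noteq> X \<and> (\<forall>l \<in> set ls. marked {2} l)))"

lemma valid_internal_cover_grammar:
  assumes G: "context_free_grammar G" and X: "X \<in> nonterminals G" and "ls \<noteq> []"
  shows "valid_internal (cover_grammar G X) l ls \<longleftrightarrow>
    valid_internal G (unmark l) (map unmark ls) \<and> valid_marks X l ls"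
proof -
  let ?P = "\<lambda>Z. \<exists>w. (Z, w) \<in> rules G \<and> map unmark ls = rhs_labels w"
  let ?T = "\<lambda>i Z. \<exists>w. (Z, w) \<in> rules G \<and> ls = rhs_labels (tag i w)"
  let ?T12 = "\<lambda>Z. \<exists>w. (Z, w) \<in> rules G \<and> (\<exists>w' \<in> tag12 w. ls = rhs_labels w')"
  have "valid_internal (cover_grammar G X) l ls \<longleftrightarrow>
      (\<exists>Z i. l = Sym (Nt (Z, i)) \<and> (\<exists>w. ((Z, i), w) \<in> rules (cover_grammar G X) \<and> ls = rhs_labels w))"
    using valid_internal_iff[OF context_free_grammar_cover_grammar[OF G X] \<open>ls \<noteq> []\<close>] by auto
  also have "\<dots> \<longleftrightarrow> (\<exists>Z i. l = Sym (Nt (Z, i)) \<and>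
      (i = 0 \<and> ?T 0 Z \<or> i = 1 \<and> Z = X \<and> ?T 0 Z \<or> i = 1 \<and> Z \<noteq> X \<and> ?T12 Z \<or>
       i = 2 \<and> Z \<noteq> X \<and> ?T 2 Z))"
  proof -
    have "(\<exists>w. ((Z, i), w) \<in> rules (cover_grammar G X) \<and> ls = rhs_labels w) \<longleftrightarrow>
      (i = 0 \<and> ?T 0 Z \<or> i = 1 \<and> Z = X \<and> ?T 0 Z \<or> i = 1 \<and> Z \<noteq> X \<and> ?T12 Z \<or>
       i = 2 \<and> Z \<noteq> X \<and> ?T 2 Z)" for Z i
      by (simp add: cover_grammar_def rules0_def rules1_def rules1'_def rules2_def) blast
    then show ?thesis by simp
  qed
  \<comment> \<open>Rewriting the right-hand sides makes \<open>?P Z\<close> a common factor of all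
    four disjuncts; pulling it out leaves exactly \<open>valid_marks\<close>.\<close>
  also have "\<dots> \<longleftrightarrow> (\<exists>Z. unmark l = Sym (Nt Z) \<and> ?P Z) \<and> valid_marks X l ls"
    unfolding rhs_labels_tag_iff rhs_labels_tag12_iff valid_marks_def unmark_eq_Nt by blast
  also have "(\<exists>Z. unmark l = Sym (Nt Z) \<and> ?P Z) \<longleftrightarrow> valid_internal G (unmark l) (map unmark ls)"
    using valid_internal_iff[OF G] \<open>ls \<noteq> []\<close> by auto
  finally show ?thesis .
qed

lemma valid_leaf_cover_grammar: "valid_leaf (cover_grammar G X) l \<longleftrightarrow> valid_leaf G (unmark l)"
proof (cases l)
  case (Sym s)
  then show ?thesis
    by (cases s) (auto simp: valid_leaf_def cover_grammar_def)
qed (simp add: valid_leaf_def)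

text \<open>The recursive calls stand under \<open>map\<close> because primitive recursion over the
  nested list of children goes through it.\<close>

primrec marked_tree :: "'n \<Rightarrow> ('t, 'n \<times> nat) label otree \<Rightarrow> bool" where
  "marked_tree X (Node l ts) \<longleftrightarrow>
     (ts \<noteq> [] \<longrightarrow> valid_marks X l (map root ts)) \<and> (\<forall>b \<in> set (map (marked_tree X) ts). b)"

lemma valid_tree_cover_grammar:
  assumes G: "context_free_grammar G" and X: "X \<in> nonterminals G"
  shows "valid_tree (cover_grammar G X) t \<longleftrightarrow> valid_tree G (map_otree unmark t) \<and> marked_tree X t"
proof (induction t)
  case (Node l ts)
  have roots: "map root (map (map_otree unmark) ts) = map unmark (map root ts)"
    by (simp add: root_map_otree)
  show ?case
  proof (cases "ts = []")
    case True
    then show ?thesis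
      by (simp add: valid_tree_Node valid_leaf_cover_grammar)
  next
    case False
    then have "valid_internal (cover_grammar G X) l (map root ts) \<longleftrightarrow>
        valid_internal G (unmark l) (map unmark (map root ts)) \<and> valid_marks X l (map root ts)"
      by (intro valid_internal_cover_grammar[OF G X]) simp
    with False Node.IH show ?thesis
      unfolding otree.map valid_tree_Node roots marked_tree.simps by auto
  qed
qed

section \<open>Marking a tree of \<open>G\<close>\<close>

text \<open>The intended inverse of erasure. Below the first \<open>X\<close> on a branch everything
  gets 0, even further occurrences of \<open>X\<close>; a subtree without \<open>X\<close> gets 2
  throughout.\<close>

fun cover_marking :: "'n \<Rightarrow> ('t, 'n) label otree \<Rightarrow> ('t, 'n \<times> nat) label otree" where
  "cover_marking X (Node l ts) =
     (if l = Sym (Nt X) then Node (mark 1 l) (map (map_otree (mark 0)) ts)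
      else if covers (Node l ts) X then Node (mark 1 l) (map (cover_marking X) ts)
      else map_otree (mark 2) (Node l ts))"

lemma cover_marking_not_covers: "\<not> covers t X \<Longrightarrow> cover_marking X t = map_otree (mark 2) t"
  by (cases t) (auto simp: covers_Node)

lemma root_cover_marking:
  "root (cover_marking X t) = mark (if covers t X then 1 else 2) (root t)"
  by (cases t) (auto simp: covers_Node)

lemma map_otree_unmark_cover_marking [simp]: "map_otree unmark (cover_marking X t) = t"
proof (induction t)
  case (Node l ts)
  then show ?case
    by (auto simp: comp_def otree.map_ident map_idI)
qed

lemma valid_tree_internalD:
  "valid_tree G (Node l ts) \<Longrightarrow> ts \<noteq> [] \<Longrightarrow> \<exists>Z. l = Sym (Nt Z)"
  by (auto simp: valid_tree_Node valid_internal_def)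

lemma valid_tree_leafD:
  "valid_tree G (Node l []) \<Longrightarrow> \<forall>Z. l \<noteq> Sym (Nt Z)"
  by (auto simp: valid_tree_Node valid_leaf_def)

text \<open>With all marks 0, \<open>valid_marks\<close> only asks that internal nodes carry
  non-terminals, which validity provides.\<close>

lemma marked_tree_mark_0: "valid_tree G t \<Longrightarrow> marked_tree X (map_otree (mark 0) t)"
proof (induction t)
  case (Node l ts)
  then show ?case
    using valid_tree_internalD[OF Node.prems]
    by (auto simp: valid_tree_Node valid_marks_def root_map_otree)
qed

lemma marked_tree_mark_2:
  "valid_tree G t \<Longrightarrow> \<not> covers t X \<Longrightarrow> marked_tree X (map_otree (mark 2) t)"
proof (induction t)
  case (Node l ts)
  then show ?case
    using valid_tree_internalD[OF Node.prems(1)]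
    by (auto simp: valid_tree_Node covers_Node valid_marks_def root_map_otree)
qed

text \<open>If the root is not \<open>X\<close> itself, some child covers \<open>X\<close>, so the
  root is internal. Hence a mark put on the root of a covering tree is visible.\<close>

lemma valid_tree_root_Nt:
  "valid_tree G t \<Longrightarrow> covers t X \<Longrightarrow> \<exists>Z. root t = Sym (Nt Z)"
  by (cases t) (auto simp: covers_Node dest: valid_tree_internalD length_pos_if_in_set)

lemma marked_tree_cover_marking: "valid_tree G t \<Longrightarrow> marked_tree X (cover_marking X t)"
proof (induction t)
  case (Node l ts)
  have valid: "valid_tree G s" if "s \<in> set ts" for s
    using Node.prems that by (simp add: valid_tree_Node)
  consider (X) "l = Sym (Nt X)" | (above) "l \<noteq> Sym (Nt X)" "covers (Node l ts) X"
    | (none) "\<not> covers (Node l ts) X"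
    by blast
  then show ?case
  proof cases
    case X
    then show ?thesis
      using valid by (auto simp: valid_marks_def root_map_otree intro: marked_tree_mark_0)
  next
    case above
    then obtain s where s: "s \<in> set ts" "covers s X"
      by (auto simp: covers_Node)
    \<comment> \<open>The child covering \<open>X\<close> is the witness for the mark 1 that
      \<open>valid_marks\<close> demands among the children.\<close>
    then obtain Y where "root (cover_marking X s) = Sym (Nt (Y, 1))"
      using valid_tree_root_Nt[OF valid[OF s(1)] s(2)] by (auto simp: root_cover_marking)
    then have Y: "Sym (Nt (Y, 1)) \<in> set (map root (map (cover_marking X) ts))"
      using s(1) by force
    obtain Z where Z: "l = Sym (Nt Z)"
      using valid_tree_root_Nt[OF Node.prems above(2)] by auto
    have "\<forall>a \<in> set (map root (map (cover_marking X) ts)). marked {1, 2} a"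
      by (auto simp: root_cover_marking)
    with Y Z above(1) have "valid_marks X (mark 1 l) (map root (map (cover_marking X) ts))"
      unfolding valid_marks_def by auto
    with above show ?thesis
      using Node.IH valid by auto
  next
    case none
    then show ?thesis
      unfolding cover_marking_not_covers[OF none] by (rule marked_tree_mark_2[OF Node.prems])
  qed
qed

section \<open>Marks determined by the erased tree\<close>

text \<open>Mark 0 is hereditary: \<open>valid_marks\<close> passes it from an internal node to all
  its children.\<close>

lemma mark_unmark_tree_0:
  assumes "marked_tree X t" "valid_tree G (map_otree unmark t)" "marked {0} (root t)"
  shows "map_otree (mark 0) (map_otree unmark t) = t"
  using assms
proof (induction t)
  case (Node l ts)
  have "s = map_otree (mark 0) (map_otree unmark s)" if s: "s \<in> set ts" for s
  proof -
    have "valid_marks X l (map root ts)"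
      using Node.prems(1) s by auto
    then have "marked {0} (root s)"
      using Node.prems(3) s by (auto simp: valid_marks_def)
    then show ?thesis
      using Node.IH[OF s] Node.prems s by (simp add: valid_tree_Node)
  qed
  then show ?case
    using Node.prems(3) by (simp add: map_idI mark_unmark)
qed

text \<open>Mark 2 is hereditary too, and its clause in \<open>valid_marks\<close> excludes
  \<open>X\<close> at every internal node; valid leaves carry no non-terminal.\<close>

lemma mark_unmark_tree_2:
  assumes "marked_tree X t" "valid_tree G (map_otree unmark t)" "marked {2} (root t)"
  shows "map_otree (mark 2) (map_otree unmark t) = t \<and> \<not> covers (map_otree unmark t) X"
  using assms
proof (induction t)
  case (Node l ts)
  have IH: "map_otree (mark 2) (map_otree unmark s) = s \<and> \<not> covers (map_otree unmark s) X"
    if s: "s \<in> set ts" for s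
  proof -
    have "valid_marks X l (map root ts)"
      using Node.prems(1) s by auto
    then have "marked {2} (root s)"
      using Node.prems(3) s by (auto simp: valid_marks_def)
    then show ?thesis
      using Node.IH[OF s] Node.prems s by (simp add: valid_tree_Node)
  qed
  have "unmark l \<noteq> Sym (Nt X)"
  proof (cases "ts = []")
    case True
    then show ?thesis
      using Node.prems(2) valid_tree_leafD by fastforce
  next
    case False
    then have "valid_marks X l (map root ts)"
      using Node.prems(1) by simp
    then show ?thesis
      using Node.prems(3) by (auto simp: valid_marks_def)
  qed
  with IH show ?case
    using Node.prems(3) by (simp add: map_idI mark_unmark covers_Node)
qed

text \<open>Both conclusions go through one induction, since \<open>cover_marking\<close> branches
  on whether the erased tree covers \<open>X\<close>.\<close>

lemma cover_marking_unmark: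
  assumes "marked_tree X t" "valid_tree G (map_otree unmark t)" "root t = Sym (Nt (Z, 1))"
  shows "cover_marking X (map_otree unmark t) = t \<and> covers (map_otree unmark t) X"
  using assms
proof (induction t arbitrary: Z)
  case (Node l ts)
  have l: "l = Sym (Nt (Z, 1))"
    using Node.prems(3) by simp
  \<comment> \<open>A valid leaf carries no non-terminal, so a node with mark 1 is internal and its
    marks are constrained.\<close>
  have "ts \<noteq> []"
    using Node.prems(2) valid_tree_leafD l by fastforce
  then have marks: "valid_marks X l (map root ts)"
    using Node.prems(1) by simp
  have sub: "marked_tree X s" "valid_tree G (map_otree unmark s)" if "s \<in> set ts" for s
    using Node.prems that by (auto simp: valid_tree_Node)
  show ?case
  proof (cases "Z = X")
    case True
    have "map_otree (mark 0) (map_otree unmark s) = s" if s: "s \<in> set ts" for s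
      using mark_unmark_tree_0[OF sub[OF s]] marks l True s by (auto simp: valid_marks_def)
    then show ?thesis
      using l True by (simp add: map_idI covers_Node)
  next
    case False
    have cm: "cover_marking X (map_otree unmark s) = s" if s: "s \<in> set ts" for s
    \<comment> \<open>The first case also contains children labelled by terminals or
      \<open>Eps\<close>, for which \<open>marked\<close> is vacuous; the others have mark
      1.\<close>
    proof (cases "marked {2} (root s)")
      case True
      then show ?thesis
        using mark_unmark_tree_2[OF sub[OF s]] cover_marking_not_covers by metis
    next
      case not_2: False
      moreover have "marked {1, 2} (root s)"
        using marks l False s by (auto simp: valid_marks_def)
      ultimately obtain Y where "root s = Sym (Nt (Y, 1))"
        by (auto simp: marked_def)
      then show ?thesis
        using Node.IH[OF s] sub[OF s] by blast
    qed
    \<comment> \<open>By induction the child with mark 1 covers \<open>X\<close>, so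
      \<open>cover_marking\<close> takes its second branch at the present node.\<close>
    obtain Y where "Sym (Nt (Y, 1)) \<in> set (map root ts)"
      using marks l False by (auto simp: valid_marks_def)
    then obtain s where s: "s \<in> set ts" "root s = Sym (Nt (Y, 1))"
      by auto
    then have "covers (map_otree unmark s) X"
      using Node.IH[OF s(1)] sub[OF s(1)] by blast
    then have "covers (map_otree unmark (Node l ts)) X"
      using s(1) by (auto simp: covers_Node)
    then show ?thesis
      using cm l False by (simp add: map_idI)
  qed
qed

section \<open>Erasure of marks as a bijection\<close>

theorem proposition1:
  fixes G :: "('t, 'n) grammar" and X :: 'n and n :: nat
  assumes "context_free_grammar G"
    and "X \<in> nonterminals G"
    and "n > 0"
  shows "\<exists>f. bij_betw f (E n (cover_grammar G X)) (E_cov X n G)"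
proof
  note valid_iff = valid_tree_cover_grammar[OF assms(1,2)]
  have root_iff: "derivation_tree (cover_grammar G X) t \<longleftrightarrow>
      root t = Sym (Nt (start G, 1)) \<and> valid_tree G (map_otree unmark t) \<and> marked_tree X t" for t
    unfolding derivation_tree_iff valid_iff by (simp add: cover_grammar_def)
  show "bij_betw (map_otree unmark) (E n (cover_grammar G X)) (E_cov X n G)"
  proof (rule bij_betw_byWitness[where f' = "cover_marking X"])
    show "\<forall>t \<in> E n (cover_grammar G X). cover_marking X (map_otree unmark t) = t"
      using cover_marking_unmark by (fastforce simp: E_def root_iff)
    show "\<forall>t \<in> E_cov X n G. map_otree unmark (cover_marking X t) = t"
      by simp
    show "map_otree unmark ` E n (cover_grammar G X) \<subseteq> E_cov X n G"
      by (auto simp: E_def E_cov_def root_iff derivation_tree_iff[of G] root_map_otree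
          num_nodes_map_otree intro: cover_marking_unmark[of X _ G "start G", THEN conjunct2])
    show "cover_marking X ` E_cov X n G \<subseteq> E n (cover_grammar G X)"
    proof (rule image_subsetI)
      fix t assume t: "t \<in> E_cov X n G"
      \<comment> \<open>\<open>cover_marking\<close> is not a plain relabelling, but erasing its
        marks is one and gives back \<open>t\<close>, so the sizes agree.\<close>
      have "num_nodes (cover_marking X t) = num_nodes t"
        using num_nodes_map_otree[of unmark "cover_marking X t"] by simp
      with t show "cover_marking X t \<in> E n (cover_grammar G X)"
        \<comment> \<open>Since \<open>t\<close> covers \<open>X\<close>, its root gets mark 1, as
          the start symbol \<open>(start G, 1)\<close> requires.\<close>
        by (auto simp: E_def E_cov_def root_iff derivation_tree_iff[of G] root_cover_marking
            intro: marked_tree_cover_marking)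
    qed
  qed
qed

end
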